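(* If $v_*$ is a minimizer of CQopt, then $(\lambda_*,u_* )$ with $u_*=Pv_*$ and $\lambda_*=\frac{1}{\gamma^2}u_*^{\top}(PAPu_*+b_0)$ is a minimizer of LGopt. Conversely, if $(\lambda_*,u_* )$ is a minimizer of LGopt, then $v_*=n_0+u_*$ is a minimizer of CQopt.
   Context: Let $A\in\mathbb{R}^{n\times n}$ be symmetric, $C\in\mathbb{R}^{n\times m}$ ($m<n$) full column rank, $b\in\mathbb{R}^m$, $n_0=C(C^{\top}C)^{-1}b$ with $\|n_0\|<1$, $\gamma=\sqrt{1-\|n_0\|^2}$, $P=I-C(C^{\top}C)^{-1}C^{\top}$ (orthogonal projector onto $\mathcal N(C^{\top})$), $b_0=PAn_0$. CQopt: minimize $v^{\top}PAPv+2v^{\top}b_0$ over $v\in n_0+\mathcal N(C^{\top})$ subject to $\|Pv\|=\gamma$. LGopt: minimize $\lambda$ over pairs $(\lambda,u)\in\mathbb{R}\times\mathbb{R}^n$ with $(PAP-\lambda I)u=-b_0$, $\|u\|=\gamma$, $u\in\mathcal N(C^{\top})$; a minimizer is a feasible pair with smallest $\lambda$. *)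

theory Defs
  imports "HOL-Analysis.Analysis"
begin

text \<open>Setting: A is n x n (real^'n^'n), C is n x m (real^'m^'n, rows indexed by 'n),
  b in R^m.  Vectors of R^n are real^'n.\<close>

definition projP :: "real^'m^'n \<Rightarrow> real^'n^'n" where
  "projP C = mat 1 - C ** matrix_inv (transpose C ** C) ** transpose C"

definition nvec0 :: "real^'m^'n \<Rightarrow> real^'m \<Rightarrow> real^'n" where
  "nvec0 C b = C *v (matrix_inv (transpose C ** C) *v b)"

definition gam :: "real^'m^'n \<Rightarrow> real^'m \<Rightarrow> real" where
  "gam C b = sqrt (1 - (norm (nvec0 C b))\<^sup>2)"

definition bvec0 :: "real^'n^'n \<Rightarrow> real^'m^'n \<Rightarrow> real^'m \<Rightarrow> real^'n" where
  "bvec0 A C b = projP C *v (A *v nvec0 C b)"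

text \<open>Objective of CQopt: v' PAP v + 2 v' b0.\<close>
definition cq_obj :: "real^'n^'n \<Rightarrow> real^'m^'n \<Rightarrow> real^'m \<Rightarrow> real^'n \<Rightarrow> real" where
  "cq_obj A C b v = v \<bullet> ((projP C ** A ** projP C) *v v) + 2 * (v \<bullet> bvec0 A C b)"

text \<open>Feasible set of CQopt: v \<in> n0 + N(C'), ||Pv|| = gamma.\<close>
definition cq_feasible :: "real^'m^'n \<Rightarrow> real^'m \<Rightarrow> real^'n \<Rightarrow> bool" where
  "cq_feasible C b v \<longleftrightarrow> transpose C *v (v - nvec0 C b) = 0 \<and> norm (projP C *v v) = gam C b"

definition cq_minimizer :: "real^'n^'n \<Rightarrow> real^'m^'n \<Rightarrow> real^'m \<Rightarrow> real^'n \<Rightarrow> bool" where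
  "cq_minimizer A C b v \<longleftrightarrow> cq_feasible C b v \<and>
     (\<forall>w. cq_feasible C b w \<longrightarrow> cq_obj A C b v \<le> cq_obj A C b w)"

text \<open>Feasible pairs of LGopt: (PAP - lambda I) u = -b0, ||u|| = gamma, u \<in> N(C').\<close>
definition lg_feasible :: "real^'n^'n \<Rightarrow> real^'m^'n \<Rightarrow> real^'m \<Rightarrow> real \<Rightarrow> real^'n \<Rightarrow> bool" where
  "lg_feasible A C b lam u \<longleftrightarrow>
     (projP C ** A ** projP C - lam *\<^sub>R mat 1) *v u = - bvec0 A C b \<and>
     norm u = gam C b \<and> transpose C *v u = 0"

definition lg_minimizer :: "real^'n^'n \<Rightarrow> real^'m^'n \<Rightarrow> real^'m \<Rightarrow> real \<Rightarrow> real^'n \<Rightarrow> bool" where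
  "lg_minimizer A C b lam u \<longleftrightarrow> lg_feasible A C b lam u \<and>
     (\<forall>mu w. lg_feasible A C b mu w \<longrightarrow> lam \<le> mu)"

end

theory Submission
  imports Defs
begin

(* Substituting v = n0 + u with u in N(C^T) turns CQopt into minimising the quadratic
   F(u) = u'Mu + 2u'b0, M = PAP, over the sphere ||u|| = gamma of the M-invariant subspace N(C^T).
   A minimiser is a Lagrange point, Mu + b0 = lambda u, as one sees by differentiating F along the
   great circles through u.  For any two Lagrange points u, w on the sphere
   F(w) - F(u) = (mu - lambda)/2 ||w - u||^2,
   so comparing Lagrange points by F is the same as comparing their multipliers; together with the
   existence of a minimiser on the compact sphere this gives both directions. *)

definition quad_obj :: "('a::real_inner \<Rightarrow> 'a) \<Rightarrow> 'a \<Rightarrow> 'a \<Rightarrow> real" where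
  "quad_obj f b w = w \<bullet> f w + 2 * (w \<bullet> b)"

lemma quad_obj_stationary_diff:
  assumes sym: "\<And>x y. x \<bullet> f y = f x \<bullet> y"
    and u: "f u + b = lam *\<^sub>R u" and w: "f w + b = mu *\<^sub>R w" and norm_eq: "norm u = norm w"
  shows "quad_obj f b w - quad_obj f b u = (mu - lam) / 2 * (norm (w - u))\<^sup>2"
proof -
  have inner_stationary: "x \<bullet> f y + x \<bullet> b = c * (x \<bullet> y)" if "f y + b = c *\<^sub>R y" for x y c
    using arg_cong[OF that, of "inner x"] by (simp add: inner_add_right)
  have sym_uw: "u \<bullet> f w = w \<bullet> f u" using sym[of u w] sym[of w u] by (simp add: inner_commute)
  have same_norm: "u \<bullet> u = w \<bullet> w" using norm_eq by (simp flip: power2_norm_eq_inner)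
  have "quad_obj f b w - quad_obj f b u = (mu - lam) * (w \<bullet> w - u \<bullet> w)"
    using inner_stationary[OF u, of u] inner_stationary[OF u, of w]
      inner_stationary[OF w, of u] inner_stationary[OF w, of w] sym_uw same_norm
    unfolding quad_obj_def by (simp add: inner_commute[of w u] algebra_simps)
  also have "w \<bullet> w - u \<bullet> w = (norm (w - u))\<^sup>2 / 2"
    using same_norm
    by (simp add: power2_norm_eq_inner inner_diff_left inner_diff_right inner_commute[of w u])
  finally show ?thesis by simp
qed

lemma stationary_quad_obj_le_iff:
  assumes sym: "\<And>x y. x \<bullet> f y = f x \<bullet> y"
    and u: "f u + b = lam *\<^sub>R u" and w: "f w + b = mu *\<^sub>R w"
    and norm_eq: "norm u = norm w" and "u \<noteq> 0"
  shows "quad_obj f b u \<le> quad_obj f b w \<longleftrightarrow> lam \<le> mu"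
proof (cases "w = u")
  case True
  then have "lam *\<^sub>R u = mu *\<^sub>R u" using u w by metis
  then show ?thesis using True \<open>u \<noteq> 0\<close> by simp
next
  case False
  then have dist_pos: "(norm (w - u))\<^sup>2 > 0" by simp
  have "quad_obj f b u \<le> quad_obj f b w \<longleftrightarrow> 0 \<le> (mu - lam) / 2 * (norm (w - u))\<^sup>2"
    using quad_obj_stationary_diff[OF sym u w norm_eq] by linarith
  also have "\<dots> \<longleftrightarrow> lam \<le> mu" using dist_pos by (simp add: zero_le_mult_iff)
  finally show ?thesis .
qed

lemma arg_min_on_sphere_orthogonal:
  assumes sym: "\<And>x y. x \<bullet> f y = f x \<bullet> y" and lin: "linear f" and V: "subspace V"
    and min: "is_arg_min (quad_obj f b) (\<lambda>w. w \<in> V \<inter> sphere 0 (norm u)) u"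
    and e: "e \<in> V" "e \<bullet> u = 0" "norm e = norm u"
  shows "e \<bullet> (f u + b) = 0"
proof -
  define \<gamma> where "\<gamma> t = cos t *\<^sub>R u + sin t *\<^sub>R e" for t
  define \<phi> where "\<phi> t = (cos t)\<^sup>2 * (u \<bullet> f u) + 2 * cos t * sin t * (e \<bullet> f u)
      + (sin t)\<^sup>2 * (e \<bullet> f e) + 2 * cos t * (u \<bullet> b) + 2 * sin t * (e \<bullet> b)" for t
  have "u \<in> V" using min by (simp add: is_arg_min_def)
  have "\<gamma> t \<in> V" for t
    unfolding \<gamma>_def using V \<open>u \<in> V\<close> e(1) by (intro subspace_add subspace_scale)
  moreover have "norm (\<gamma> t) = norm u" for t
  proof -
    have "e \<bullet> e = u \<bullet> u" using e(3) by (simp flip: power2_norm_eq_inner)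
    then have "(norm (\<gamma> t))\<^sup>2 = cos t * cos t * (u \<bullet> u) + sin t * sin t * (u \<bullet> u)"
      using e(2) unfolding \<gamma>_def power2_norm_eq_inner
      by (simp add: inner_add_left inner_add_right inner_commute[of u e] algebra_simps)
    also have "\<dots> = (norm u)\<^sup>2"
      by (simp add: power2_norm_eq_inner flip: distrib_right power2_eq_square)
    finally have "(norm (\<gamma> t))\<^sup>2 = (norm u)\<^sup>2" .
    then show ?thesis by (simp add: power2_eq_iff_nonneg)
  qed
  ultimately have "quad_obj f b u \<le> quad_obj f b (\<gamma> t)" for t
    using min by (simp add: is_arg_min_linorder)
  moreover have "quad_obj f b (\<gamma> t) = \<phi> t" for t
    using sym[of u e] unfolding quad_obj_def \<gamma>_def \<phi>_def
    by (simp add: linear_add[OF lin] linear_scale[OF lin] inner_add_left inner_add_right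
        inner_commute[of "f e" u] inner_commute[of "f u" e] power2_eq_square algebra_simps)
  ultimately have "\<forall>t. \<bar>0 - t\<bar> < 1 \<longrightarrow> \<phi> 0 \<le> \<phi> t"
    by (metis \<gamma>_def cos_zero sin_zero scaleR_one scaleR_zero_left add_0_right)
  moreover have "(\<phi> has_real_derivative 2 * (e \<bullet> f u) + 2 * (e \<bullet> b)) (at 0)"
    unfolding \<phi>_def by (auto intro!: derivative_eq_intros)
  ultimately have "2 * (e \<bullet> f u) + 2 * (e \<bullet> b) = 0"
    using DERIV_local_min zero_less_one by blast
  then show ?thesis by (simp add: inner_add_right)
qed

lemma arg_min_on_sphere_stationary:
  assumes sym: "\<And>x y. x \<bullet> f y = f x \<bullet> y" and lin: "linear f" and V: "subspace V"
    and g: "g > 0" and grad: "f u + b \<in> V"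
    and min: "is_arg_min (quad_obj f b) (\<lambda>w. w \<in> V \<inter> sphere 0 g) u"
  shows "f u + b = ((1 / g\<^sup>2) * (u \<bullet> (f u + b))) *\<^sub>R u"
proof -
  have u: "u \<in> V" "norm u = g" using min by (auto simp: is_arg_min_def)
  define h where "h = (f u + b) - ((1 / g\<^sup>2) * (u \<bullet> (f u + b))) *\<^sub>R u"
  have "h \<in> V" unfolding h_def using V grad u(1) by (intro subspace_diff subspace_scale)
  have "h \<bullet> u = (f u + b) \<bullet> u - (1 / g\<^sup>2) * (u \<bullet> (f u + b)) * (u \<bullet> u)"
    unfolding h_def by (simp add: inner_diff_left)
  also have "\<dots> = 0"
    using u(2) g by (simp add: inner_commute[of "f u + b" u] flip: power2_norm_eq_inner)
  finally have "h \<bullet> u = 0" .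
  have "h \<bullet> (f u + b) = 0"
  proof (cases "h = 0")
    case False
    have "((g / norm h) *\<^sub>R h) \<bullet> (f u + b) = 0"
      using \<open>h \<in> V\<close> \<open>h \<bullet> u = 0\<close> False g u(2) min
      by (intro arg_min_on_sphere_orthogonal[OF sym lin V]) (auto intro: subspace_scale[OF V])
    then show ?thesis using False g by simp
  qed simp
  then have "h \<bullet> h = 0"
    using \<open>h \<bullet> u = 0\<close> unfolding h_def by (simp add: inner_diff_right)
  then show ?thesis unfolding h_def by simp
qed

lemma quad_obj_attains_min_on_sphere:
  fixes f :: "'a::euclidean_space \<Rightarrow> 'a"
  assumes lin: "linear f" and V: "subspace V" and "V \<noteq> {0}" and "g \<ge> 0"
  obtains u where "is_arg_min (quad_obj f b) (\<lambda>w. w \<in> V \<inter> sphere 0 g) u"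
proof -
  obtain x where "x \<in> V" "x \<noteq> 0" using \<open>V \<noteq> {0}\<close> subspace_0[OF V] by auto
  then have "(g / norm x) *\<^sub>R x \<in> V \<inter> sphere 0 g"
    using \<open>g \<ge> 0\<close> by (simp add: subspace_scale[OF V])
  moreover have "compact (V \<inter> sphere 0 g)"
    using closed_Int_compact[OF closed_subspace[OF V] compact_sphere] .
  moreover have "continuous_on (V \<inter> sphere 0 g) f"
    using lin by (simp add: linear_conv_bounded_linear linear_continuous_on)
  then have "continuous_on (V \<inter> sphere 0 g) (quad_obj f b)"
    unfolding quad_obj_def by (intro continuous_intros)
  ultimately obtain u where
    "u \<in> V \<inter> sphere 0 g" "\<forall>w \<in> V \<inter> sphere 0 g. quad_obj f b u \<le> quad_obj f b w"
    using continuous_attains_inf by blast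
  then show ?thesis using that unfolding is_arg_min_linorder by blast
qed

lemma arg_min_on_sphere_least_multiplier:
  assumes sym: "\<And>x y. x \<bullet> f y = f x \<bullet> y" and lin: "linear f" and V: "subspace V"
    and invariant: "\<And>x. x \<in> V \<Longrightarrow> f x \<in> V" and "b \<in> V" and g: "g > 0"
    and min: "is_arg_min (quad_obj f b) (\<lambda>w. w \<in> V \<inter> sphere 0 g) u"
  shows "f u + b = ((1 / g\<^sup>2) * (u \<bullet> (f u + b))) *\<^sub>R u"
    and "w \<in> V \<inter> sphere 0 g \<Longrightarrow> f w + b = mu *\<^sub>R w \<Longrightarrow> (1 / g\<^sup>2) * (u \<bullet> (f u + b)) \<le> mu"
proof -
  let ?lam = "(1 / g\<^sup>2) * (u \<bullet> (f u + b))"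
  have u: "u \<in> V" "norm u = g" using min by (auto simp: is_arg_min_def)
  show stationary: "f u + b = ?lam *\<^sub>R u"
    using u(1) \<open>b \<in> V\<close> g min
    by (intro arg_min_on_sphere_stationary[OF sym lin V]) (auto intro: subspace_add[OF V] invariant)
  assume "w \<in> V \<inter> sphere 0 g" and w: "f w + b = mu *\<^sub>R w"
  then have "quad_obj f b u \<le> quad_obj f b w" using min by (simp add: is_arg_min_linorder)
  then show "?lam \<le> mu"
    using stationary_quad_obj_le_iff[OF sym stationary w] u g \<open>w \<in> V \<inter> sphere 0 g\<close> by auto
qed

lemma least_multiplier_imp_arg_min_on_sphere:
  fixes f :: "'a::euclidean_space \<Rightarrow> 'a"
  assumes sym: "\<And>x y. x \<bullet> f y = f x \<bullet> y" and lin: "linear f" and V: "subspace V"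
    and invariant: "\<And>x. x \<in> V \<Longrightarrow> f x \<in> V" and "b \<in> V" and g: "g > 0" and "V \<noteq> {0}"
    and u: "u \<in> V \<inter> sphere 0 g" and stationary: "f u + b = lam *\<^sub>R u"
    and least: "\<And>mu w. w \<in> V \<inter> sphere 0 g \<Longrightarrow> f w + b = mu *\<^sub>R w \<Longrightarrow> lam \<le> mu"
  shows "is_arg_min (quad_obj f b) (\<lambda>w. w \<in> V \<inter> sphere 0 g) u"
proof -
  obtain u' where min': "is_arg_min (quad_obj f b) (\<lambda>w. w \<in> V \<inter> sphere 0 g) u'"
    using quad_obj_attains_min_on_sphere[OF lin V \<open>V \<noteq> {0}\<close> less_imp_le[OF g]] by blast
  then have u': "u' \<in> V \<inter> sphere 0 g" by (simp add: is_arg_min_def)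
  note stationary' =
    arg_min_on_sphere_least_multiplier(1)[OF sym lin V invariant \<open>b \<in> V\<close> g min']
  have "quad_obj f b u \<le> quad_obj f b u'"
    using stationary_quad_obj_le_iff[OF sym stationary stationary'] least[OF u' stationary'] u u' g
    by auto
  then show ?thesis using min' u unfolding is_arg_min_linorder by (meson order_trans)
qed

lemma inner_matrix_vector_transpose:
  fixes A :: "real^'n^'m"
  shows "x \<bullet> (A *v y) = (transpose A *v x) \<bullet> y"
  by (simp add: dot_lmul_matrix)

lemma matrix_mul3_vector: "(P ** A ** Q) *v x = P *v (A *v (Q *v x))"
  by (simp only: matrix_vector_mul_assoc matrix_mul_assoc)

lemma matrix_inv_left_right:
  assumes "invertible A"
  shows "matrix_inv A ** A = mat 1" and "A ** matrix_inv A = mat 1"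
proof -
  have "A ** matrix_inv A = mat 1 \<and> matrix_inv A ** A = mat 1"
    using assms unfolding invertible_def matrix_inv_def by (rule someI_ex)
  then show "matrix_inv A ** A = mat 1" and "A ** matrix_inv A = mat 1" by auto
qed

lemma transpose_matrix_inv:
  fixes A :: "'a::comm_semiring_1^'n^'m"
  assumes "invertible A"
  shows "transpose (matrix_inv A) = matrix_inv (transpose A)"
proof -
  have "transpose (matrix_inv A) ** transpose A = mat 1"
    and right: "transpose A ** transpose (matrix_inv A) = mat 1"
    using matrix_inv_left_right[OF assms]
    by (metis matrix_transpose_mul transpose_mat)+
  then have "invertible (transpose A)" unfolding invertible_def by blast
  then have "matrix_inv (transpose A)
      = matrix_inv (transpose A) ** (transpose A ** transpose (matrix_inv A))"
    using right by simp
  also have "\<dots> = transpose (matrix_inv A)"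
    using matrix_inv_left_right(1)[OF \<open>invertible (transpose A)\<close>] by (simp add: matrix_mul_assoc)
  finally show ?thesis by simp
qed

lemma invertible_gram:
  fixes C :: "real^'m^'n"
  assumes "rank C = CARD('m)"
  shows "invertible (transpose C ** C)"
proof -
  have "x = 0" if "(transpose C ** C) *v x = 0" for x
  proof -
    have "(C *v x) \<bullet> (C *v x) = x \<bullet> ((transpose C ** C) *v x)"
      using dot_lmul_matrix[of x "transpose C" "C *v x"] by (simp flip: matrix_vector_mul_assoc)
    then have "C *v x = 0" using that by simp
    then show "x = 0" using assms matrix_nonfull_linear_equations_eq by blast
  qed
  then show ?thesis using matrix_left_invertible_ker invertible_left_inverse by blast
qed

lemma gam_pos: "norm (nvec0 C b) < 1 \<Longrightarrow> gam C b > 0"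
  by (simp add: gam_def abs_square_less_1)

lemma projP_apply:
  "projP C *v x = x - C *v (matrix_inv (transpose C ** C) *v (transpose C *v x))"
  unfolding projP_def
  by (simp only: matrix_vector_mult_diff_rdistrib matrix_vector_mul_lid matrix_vector_mul_assoc
      matrix_mul_assoc)

lemma lg_feasible_iff:
  "lg_feasible A C b lam u \<longleftrightarrow>
     u \<in> {w. transpose C *v w = 0} \<inter> sphere 0 (gam C b) \<and>
     (projP C ** A ** projP C) *v u + bvec0 A C b = lam *\<^sub>R u"
proof -
  have "(projP C ** A ** projP C - lam *\<^sub>R mat 1) *v u
      = (projP C ** A ** projP C) *v u - lam *\<^sub>R u"
    by (simp add: matrix_vector_mult_diff_rdistrib flip: scaleR_matrix_vector_assoc)
  then show ?thesis unfolding lg_feasible_def by (auto simp: algebra_simps eq_neg_iff_add_eq_0)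
qed

context
  fixes C :: "real^'m^'n"
  assumes rank: "rank C = CARD('m)"
begin

lemma null_space_transpose_nontrivial:
  assumes "CARD('m) < CARD('n)"
  shows "{w. transpose C *v w = 0} \<noteq> {0}"
proof -
  have "rank (transpose C) \<noteq> CARD('n)" using assms rank by (simp add: rank_transpose)
  then show ?thesis using matrix_nonfull_linear_equations_eq by fastforce
qed

lemma transpose_mult_gram_inv: "transpose C *v (C *v (matrix_inv (transpose C ** C) *v z)) = z"
  by (simp only: matrix_vector_mul_assoc matrix_mul_assoc matrix_vector_mul_lid
      matrix_inv_left_right(2)[OF invertible_gram[OF rank]])

lemma transpose_mult_projP_apply: "transpose C *v (projP C *v x) = 0"
  by (simp only: projP_apply matrix_vector_mult_diff_distrib transpose_mult_gram_inv diff_self)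

lemma projP_apply_null_space: "transpose C *v u = 0 \<Longrightarrow> projP C *v u = u"
  by (simp add: projP_apply)

lemma projP_nvec0: "projP C *v nvec0 C b = 0"
  unfolding projP_apply nvec0_def transpose_mult_gram_inv by simp

lemma inner_projP_symmetric: "x \<bullet> (projP C *v y) = (projP C *v x) \<bullet> y"
proof -
  define K where "K = matrix_inv (transpose C ** C)"
  have "transpose K = K"
    using transpose_matrix_inv[OF invertible_gram[OF rank]] unfolding K_def
    by (simp add: matrix_transpose_mul)
  then have K_sym: "a \<bullet> (K *v c) = c \<bullet> (K *v a)" for a c
    by (metis inner_matrix_vector_transpose inner_commute)
  have "x \<bullet> (C *v (K *v (transpose C *v y))) = y \<bullet> (C *v (K *v (transpose C *v x)))"
    by (simp only: inner_matrix_vector_transpose[of _ C] K_sym)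
  then show ?thesis
    unfolding projP_apply K_def[symmetric]
    by (simp add: inner_diff_left inner_diff_right inner_commute)
qed

lemma inner_nvec0_projP: "nvec0 C b \<bullet> (projP C *v x) = 0"
  by (simp add: inner_projP_symmetric projP_nvec0)

lemma projP_eq_diff_nvec0:
  "transpose C *v (v - nvec0 C b) = 0 \<Longrightarrow> projP C *v v = v - nvec0 C b"
  by (metis projP_apply_null_space projP_nvec0 matrix_vector_mult_diff_distrib diff_zero)

lemma cq_feasible_iff:
  "cq_feasible C b v \<longleftrightarrow> v - nvec0 C b \<in> {w. transpose C *v w = 0} \<inter> sphere 0 (gam C b)"
  unfolding cq_feasible_def using projP_eq_diff_nvec0 by auto

lemma cq_obj_nvec0_add:
  "cq_obj A C b (nvec0 C b + u) = quad_obj ((*v) (projP C ** A ** projP C)) (bvec0 A C b) u"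
  unfolding cq_obj_def quad_obj_def bvec0_def matrix_mul3_vector
  by (simp add: matrix_vector_right_distrib inner_add_left inner_add_right inner_nvec0_projP
      projP_nvec0)

lemma cq_minimizer_iff_arg_min:
  "cq_minimizer A C b v \<longleftrightarrow>
     is_arg_min (quad_obj ((*v) (projP C ** A ** projP C)) (bvec0 A C b))
       (\<lambda>w. w \<in> {w. transpose C *v w = 0} \<inter> sphere 0 (gam C b)) (v - nvec0 C b)"
proof -
  have obj: "cq_obj A C b w
      = quad_obj ((*v) (projP C ** A ** projP C)) (bvec0 A C b) (w - nvec0 C b)" for w
    using cq_obj_nvec0_add[of A b "w - nvec0 C b"] by simp
  show ?thesis
    unfolding cq_minimizer_def is_arg_min_linorder cq_feasible_iff obj
    by (metis add_diff_cancel_left')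
qed

lemma inner_PAP_symmetric:
  assumes "transpose A = A"
  shows "x \<bullet> ((projP C ** A ** projP C) *v y) = ((projP C ** A ** projP C) *v x) \<bullet> y"
  unfolding matrix_mul3_vector
  by (metis assms inner_projP_symmetric inner_matrix_vector_transpose)

end

theorem theorem2p2:
  fixes A :: "real^'n^'n" and C :: "real^'m^'n" and b :: "real^'m"
  assumes symA: "transpose A = A"
    and mn: "CARD('m) < CARD('n)"
    and rankC: "rank C = CARD('m)"
    and n0: "norm (nvec0 C b) < 1"
  shows "(\<forall>v. cq_minimizer A C b v \<longrightarrow>
            (let u = projP C *v v in
             lg_minimizer A C b
               ((1 / (gam C b)\<^sup>2) * (u \<bullet> ((projP C ** A ** projP C) *v u + bvec0 A C b))) u))
       \<and> (\<forall>lam u. lg_minimizer A C b lam u \<longrightarrow> cq_minimizer A C b (nvec0 C b + u))"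
proof -
  let ?V = "{w. transpose C *v w = 0}"
  let ?M = "projP C ** A ** projP C"
  have V: "subspace ?V" by (rule real_vector.linear_subspace_kernel[OF matrix_vector_mul_linear])
  have invariant: "?M *v x \<in> ?V" for x
    unfolding mem_Collect_eq matrix_mul3_vector by (rule transpose_mult_projP_apply[OF rankC])
  have b0: "bvec0 A C b \<in> ?V"
    unfolding mem_Collect_eq bvec0_def by (rule transpose_mult_projP_apply[OF rankC])
  note setting = inner_PAP_symmetric[OF rankC symA] matrix_vector_mul_linear V invariant b0
    gam_pos[OF n0]
  show ?thesis
  proof (intro conjI allI impI)
    fix v assume cq_min: "cq_minimizer A C b v"
    then have min: "is_arg_min (quad_obj ((*v) ?M) (bvec0 A C b))
        (\<lambda>w. w \<in> ?V \<inter> sphere 0 (gam C b)) (v - nvec0 C b)"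
      using cq_minimizer_iff_arg_min[OF rankC] by blast
    have "projP C *v v = v - nvec0 C b"
      using cq_min projP_eq_diff_nvec0[OF rankC]
      unfolding cq_minimizer_def cq_feasible_def by blast
    then show "let u = projP C *v v in
        lg_minimizer A C b ((1 / (gam C b)\<^sup>2) * (u \<bullet> (?M *v u + bvec0 A C b))) u"
      using min arg_min_on_sphere_least_multiplier[OF setting min]
      by (auto simp: Let_def lg_minimizer_def lg_feasible_iff is_arg_min_def)
  next
    fix lam u assume "lg_minimizer A C b lam u"
    then show "cq_minimizer A C b (nvec0 C b + u)"
      using least_multiplier_imp_arg_min_on_sphere
          [OF setting null_space_transpose_nontrivial[OF rankC mn]]
      by (auto simp: cq_minimizer_iff_arg_min[OF rankC] lg_minimizer_def lg_feasible_iff)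
  qed
qed

end
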